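(* If $G\in\mathbb{Np}^\infty$ is a symmetric form, then $o(G)\in\{\mathscr N,\mathscr P\}$.
   Context: Affine normal play forms $\mathbb{Np}^\infty$ are defined recursively: two atomic forms $\infty$ and $\overline{\infty}$ with no options; every other form is $G=\{G^{\mathcal L}\mid G^{\mathcal R}\}$ with finite nonempty sets of previously constructed forms as Left and Right options. Outcomes: Left wins $\infty$ and Right wins $\overline{\infty}$ whoever moves; otherwise play alternates, Left moving first wins iff some Left option is won by Left moving second, Left moving second wins iff every Right option is won by Left moving first, symmetrically for Right. $o(G)$ is $\mathscr L$ (Left wins moving first and second), $\mathscr R$ (Right wins either way), $\mathscr N$ (first player wins), $\mathscr P$ (second player wins). Conjugate $\overline G$: $\overline\infty$ if $G=\infty$, $\infty$ if $G=\overline\infty$, otherwise $\{\overline{G^R}\mid\overline{G^L}\}$ (conjugating each option). $G$ is symmetric if $G\notin\{\infty,\overline\infty\}$ and $G^{\mathcal R}=\{\overline{G^L}:G^L\in G^{\mathcal L}\}$. *)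

theory Defs
  imports "HOL-Library.FSet"
begin

datatype player = Left | Right

text \<open>
  Raw forms: \<open>Infty\<close> is the atom won by Left, \<open>Minfty\<close> (infinity with an overline) the atom won
  by Right, and \<open>Form Ls Rs\<close> has finite sets of Left options \<open>Ls\<close> and Right options \<open>Rs\<close>.
  The datatype allows empty option sets; the affine normal play forms are the raw forms in
  \<open>Np_infty\<close> below, where both sets are nonempty, hereditarily.
\<close>

datatype form = Infty | Minfty | Form "form fset" "form fset"

inductive_set Np_infty :: "form set" where
  Infty: "Infty \<in> Np_infty"
| Minfty: "Minfty \<in> Np_infty"
| Form: "\<lbrakk>Ls \<noteq> {||}; Rs \<noteq> {||};
    \<And>H. H |\<in>| Ls \<Longrightarrow> H \<in> Np_infty; \<And>H. H |\<in>| Rs \<Longrightarrow> H \<in> Np_infty\<rbrakk>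
    \<Longrightarrow> Form Ls Rs \<in> Np_infty"

lemma size_option_less [termination_simp]:
  fixes H :: form
  shows "H |\<in>| A \<Longrightarrow> size H < Suc ((\<Sum>x\<in>fset A. Suc (size x)) + (\<Sum>x\<in>fset B. Suc (size x)))"
    and "H |\<in>| B \<Longrightarrow> size H < Suc ((\<Sum>x\<in>fset A. Suc (size x)) + (\<Sum>x\<in>fset B. Suc (size x)))"
proof -
  have *: "size H < (\<Sum>x\<in>fset C. Suc (size x))" if "H |\<in>| C" for C :: "form fset"
  proof -
    have "Suc (size H) \<le> (\<Sum>x\<in>fset C. Suc (size x))"
      using that by (intro member_le_sum) auto
    then show ?thesis by simp
  qed
  show "H |\<in>| A \<Longrightarrow> size H < Suc ((\<Sum>x\<in>fset A. Suc (size x)) + (\<Sum>x\<in>fset B. Suc (size x)))"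
    using * [of A] by linarith
  show "H |\<in>| B \<Longrightarrow> size H < Suc ((\<Sum>x\<in>fset A. Suc (size x)) + (\<Sum>x\<in>fset B. Suc (size x)))"
    using * [of B] by linarith
qed

text \<open>\<open>wins p q G\<close>: player \<open>p\<close> wins \<open>G\<close> when player \<open>q\<close> moves first.\<close>

fun wins :: "player \<Rightarrow> player \<Rightarrow> form \<Rightarrow> bool" where
  "wins p q Infty \<longleftrightarrow> p = Left"
| "wins p q Minfty \<longleftrightarrow> p = Right"
| "wins Left Left (Form Ls Rs) \<longleftrightarrow> (\<exists>H\<in>fset Ls. wins Left Right H)"
| "wins Left Right (Form Ls Rs) \<longleftrightarrow> (\<forall>H\<in>fset Rs. wins Left Left H)"
| "wins Right Right (Form Ls Rs) \<longleftrightarrow> (\<exists>H\<in>fset Rs. wins Right Left H)"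
| "wins Right Left (Form Ls Rs) \<longleftrightarrow> (\<forall>H\<in>fset Ls. wins Right Right H)"

lemma wins_determined: "wins Right q G \<longleftrightarrow> \<not> wins Left q G"
proof (induction G arbitrary: q)
  case (Form Ls Rs)
  then show ?case by (cases q) simp_all
qed simp_all

datatype outcome_class = LeftWin | RightWin | NextWin | PreviousWin

primrec has_outcome :: "form \<Rightarrow> outcome_class \<Rightarrow> bool" where
  "has_outcome G LeftWin \<longleftrightarrow> wins Left Left G \<and> wins Left Right G"
| "has_outcome G RightWin \<longleftrightarrow> wins Right Left G \<and> wins Right Right G"
| "has_outcome G NextWin \<longleftrightarrow> wins Left Left G \<and> wins Right Right G"
| "has_outcome G PreviousWin \<longleftrightarrow> wins Left Right G \<and> wins Right Left G"

lemma has_outcome_unique: "\<exists>!c. has_outcome G c"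
proof -
  have *: "has_outcome G c \<longleftrightarrow>
      c = (if wins Left Left G then if wins Left Right G then LeftWin else NextWin
           else if wins Left Right G then PreviousWin else RightWin)" for c
    by (cases c) (auto simp: wins_determined)
  show ?thesis unfolding * by simp
qed

definition outcome :: "form \<Rightarrow> outcome_class" where
  "outcome G = (THE c. has_outcome G c)"

lemma outcome_eq_iff: "outcome G = c \<longleftrightarrow> has_outcome G c"
  unfolding outcome_def by (metis has_outcome_unique the1_equality)

primrec conjugate :: "form \<Rightarrow> form" where
  "conjugate Infty = Minfty"
| "conjugate Minfty = Infty"
| "conjugate (Form Ls Rs) = Form (conjugate |`| Rs) (conjugate |`| Ls)"

definition symmetric_form :: "form \<Rightarrow> bool" where
  "symmetric_form G \<longleftrightarrow> (\<exists>Ls Rs. G = Form Ls Rs \<and> Rs = conjugate |`| Ls)"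

end

theory Submission
  imports Defs
begin

text \<open>Conjugation swaps the players, and in a symmetric form Right's options are the
  conjugates of Left's; so Left wins moving first iff Right does. The four equations go by one
  induction, as each needs its partner with the other starter.\<close>

lemma wins_conjugate:
  "wins Left Left (conjugate G) \<longleftrightarrow> wins Right Right G"
  "wins Left Right (conjugate G) \<longleftrightarrow> wins Right Left G"
  "wins Right Left (conjugate G) \<longleftrightarrow> wins Left Right G"
  "wins Right Right (conjugate G) \<longleftrightarrow> wins Left Left G"
  by (induction G) simp_all

theorem theorem3p3:
  fixes G :: form
  assumes "G \<in> Np_infty"
    and "symmetric_form G"
  shows "outcome G \<in> {NextWin, PreviousWin}"
proof -
  from assms(2) obtain Ls where G: "G = Form Ls (conjugate |`| Ls)"
    by (auto simp: symmetric_form_def)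
  have "wins Left Left G \<longleftrightarrow> wins Right Right G"
    by (simp add: G wins_conjugate)
  \<comment> \<open>If neither player wins moving first, determinacy makes each win moving
    second.\<close>
  then have "has_outcome G NextWin \<or> has_outcome G PreviousWin"
    by (auto simp: wins_determined)
  then show ?thesis
    by (simp add: outcome_eq_iff)
qed

end
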